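(* For every integer $k\ge 4$, every positive integer $n$ is a sum of $k$ nonzero triangular numbers, except for $n=1,2,\ldots,k-1$, $n=k+1$, and $n=k+3$.
   Context: A triangular number is a number of the form $x(x+1)/2$ with $x\in\mathbb{Z}$; nonzero means its value is nonzero. *)

theory Defs
  imports Main
begin

text \<open>The division below is exact, since \<open>x * (x + 1)\<close> is always even.\<close>

definition triangular :: "int \<Rightarrow> bool" where
  "triangular t \<longleftrightarrow> (\<exists>x::int. t = x * (x + 1) div 2)"

definition sum_of_nonzero_triangulars :: "nat \<Rightarrow> int \<Rightarrow> bool" where
  "sum_of_nonzero_triangulars k n \<longleftrightarrow>
     (\<exists>t::nat \<Rightarrow> int. (\<forall>i<k. triangular (t i) \<and> t i \<noteq> 0) \<and> n = (\<Sum>i<k. t i))"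

end

theory Submission
  imports Defs "HOL-Computational_Algebra.Formal_Power_Series"
begin

text \<open>
  Adding ones reduces everything to four summands. Write \<open>T x = x (x + 1) / 2\<close>. The number of
  quadruples of natural numbers with \<open>T a + T b + T c + T d = n\<close> is \<open>\<sigma> (2 n + 1) \<ge> 2 n + 2\<close>
  (Legendre): both sides satisfy the recurrence coming from \<open>(\<psi>^4)' \<psi> = 4 \<psi>^4 \<psi>'\<close>, where
  \<open>\<psi> = \<Sum> q^(T x)\<close>, and for the divisor sums this is an involution argument of Zagier's kind on
  the binary quadratic forms of discriminant \<open>8 n + 5\<close>.

  Quadruples with a vanishing entry number at most four times the triples representing \<open>n\<close>. There
  are about \<open>r = sqrt (2 n)\<close> choices for one entry of such a triple, and the remaining two are
  integer points on a circular arc, of which there are at most \<open>r / 4\<close> for large \<open>r\<close> because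
  neighbouring points on the arc that are close together are determined by their difference.
  Hence for \<open>n \<ge> T 672\<close> some quadruple has no vanishing entry. For smaller \<open>n\<close> one subtracts a
  triangular number so as to land between 30 and 702, where three nonzero triangular
  numbers always suffice.
\<close>

section \<open>The number of representations by four triangular numbers\<close>

text \<open>The triple \<open>(a, b, c)\<close> stands for the indefinite form \<open>a u\<^sup>2 + b u v - c v\<^sup>2\<close>.\<close>

definition forms :: "int \<Rightarrow> (int \<times> int \<times> int) set" where
  "forms N = {(a, b, c). a > 0 \<and> c > 0 \<and> b\<^sup>2 + 4 * a * c = N}"

lemma finite_forms: "finite (forms N)"
proof (rule finite_subset)
  show "forms N \<subseteq> {1..N} \<times> {-N..N} \<times> {1..N}"
  proof
    fix t assume "t \<in> forms N"
    then obtain a b c where t: "t = (a, b, c)" and ac: "a > 0" "c > 0" and N: "N = b\<^sup>2 + 4 * (a * c)"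
      by (auto simp: forms_def)
    have "a \<le> a * c" "c \<le> a * c"
      using ac by (simp_all add: mult_le_cancel_left1 mult_le_cancel_right1)
    moreover have "\<bar>b\<bar> \<le> b\<^sup>2"
      using abs_le_square_iff[of b "b\<^sup>2"] self_le_power[of "\<bar>b\<bar>" 2] by (cases "b = 0") auto
    moreover have "b\<^sup>2 \<ge> 0" by simp
    ultimately show "t \<in> {1..N} \<times> {-N..N} \<times> {1..N}"
      using ac unfolding t N mem_Times_iff atLeastAtMost_iff fst_conv snd_conv by linarith
  qed
qed simp

lemma sum_forms_eq_0:
  fixes N :: int
  assumes nonsquare: "\<And>x. x\<^sup>2 \<noteq> N"
  shows "(\<Sum>(a, b, c)\<in>forms N. a * (a * c - b\<^sup>2)) = 0"
proof -
  \<comment> \<open>The sign of the value \<open>a + b - c\<close> of the form at \<open>(1, 1)\<close> decides which unipotent substitution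
    keeps it in \<open>forms N\<close>; composed with \<open>b \<mapsto> - b\<close> it is an involution. The summand \<open>a\<^sup>2 b\<close>, whose total
    is zero, is subtracted to make the integrand antisymmetric under this involution.\<close>
  define P where "P = {(a, b, c) \<in> forms N. c > a + b}"
  define Q where "Q = {(a, b, c) \<in> forms N. c < a + b}"
  have fin: "finite P" "finite Q"
    unfolding P_def Q_def by (auto intro: finite_subset[OF _ finite_forms])
  \<comment> \<open>On the wall \<open>c = a + b\<close> the discriminant
    \<open>b^2 + 4 * a * c\<close> would be the square of \<open>b + 2 * a\<close>.\<close>
  have "c \<noteq> a + b" if "(a, b, c) \<in> forms N" for a b c
  proof
    assume "c = a + b"
    then have "(b + 2 * a)\<^sup>2 = N"
      using that by (simp add: forms_def power2_eq_square algebra_simps)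
    then show False using nonsquare by blast
  qed
  then have split: "forms N = P \<union> Q"
    unfolding P_def Q_def by (auto simp: neq_iff)
  have disj: "P \<inter> Q = {}"
    unfolding P_def Q_def by auto
  let ?g = "\<lambda>(a, b, c). a * (a * c - b\<^sup>2) - a\<^sup>2 * b"
  \<comment> \<open>Exchanging the outer coefficients and negating \<open>b\<close> crosses the
    wall, so the whole sum becomes one over \<open>P\<close>.\<close>
  have Q: "sum ?g Q = (\<Sum>(a, b, c)\<in>P. c * (a * c - b\<^sup>2) + c\<^sup>2 * b)"
    by (rule sum.reindex_bij_witness[where i = "\<lambda>(a, b, c). (c, -b, a)" and j = "\<lambda>(a, b, c). (c, -b, a)"])
       (auto simp: P_def Q_def forms_def algebra_simps)
  let ?h = "\<lambda>(a, b, c). (a + b) * (a + c) * (c - b) :: int"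
  \<comment> \<open>The combined integrand factors as \<open>?h\<close>. The involution negates
    \<open>a + b\<close> and swaps \<open>a + c\<close> with \<open>c - b\<close>, so
    \<open>?h\<close> changes sign.\<close>
  have "sum ?h P = (\<Sum>x\<in>P. - ?h x)"
    by (rule sum.reindex_bij_witness[where i = "\<lambda>(a, b, c). (a, -b - 2 * a, c - b - a)"
          and j = "\<lambda>(a, b, c). (a, -b - 2 * a, c - b - a)"])
       (auto simp: P_def forms_def power2_eq_square algebra_simps)
  then have h0: "sum ?h P = 0"
    by (simp add: sum_negf)
  have "sum ?g (forms N) = sum ?g P + sum ?g Q"
    unfolding split by (rule sum.union_disjoint[OF fin disj])
  also have "\<dots> = sum ?h P"
    unfolding Q sum.distrib[symmetric]
    by (rule sum.cong) (auto simp: power2_eq_square algebra_simps)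
  finally have g0: "sum ?g (forms N) = 0"
    using h0 by simp
  let ?o = "\<lambda>(a, b, c). a\<^sup>2 * b :: int"
  have "sum ?o (forms N) = (\<Sum>x\<in>forms N. - ?o x)"
    by (rule sum.reindex_bij_witness[where i = "\<lambda>(a, b, c). (a, -b, c)" and j = "\<lambda>(a, b, c). (a, -b, c)"])
       (auto simp: forms_def)
  then have "sum ?o (forms N) = 0"
    by (simp add: sum_negf)
  then show ?thesis
    using g0 by (simp add: case_prod_unfold sum_subtractf)
qed

section \<open>Triangular numbers and the divisor-sum recurrence\<close>

definition tri :: "nat \<Rightarrow> nat" where
  "tri x = x * (x + 1) div 2"

lemma tri_0 [simp]: "tri 0 = 0"
  by (simp add: tri_def)

lemma double_tri: "2 * tri x = x * (x + 1)"
  unfolding tri_def by simp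

lemma tri_Suc: "tri (Suc x) = tri x + Suc x"
  using double_tri[of x] double_tri[of "Suc x"] by simp

lemma strict_mono_tri: "strict_mono tri"
  by (simp add: strict_mono_Suc_iff tri_Suc)

lemma inj_tri: "inj tri"
  using strict_mono_tri by (rule strict_mono_imp_inj_on)

lemma le_tri: "x \<le> tri x"
  using strict_mono_tri by (rule strict_mono_imp_increasing)

lemma finite_tri_le: "finite {x. tri x \<le> n}"
  by (rule finite_subset[of _ "{..n}"]) (use le_tri order_trans in auto)

definition sigma :: "nat \<Rightarrow> nat" where
  "sigma m = \<Sum>{d. d dvd m}"

text \<open>Take discriminant \<open>8 * n + 5\<close>, which is no square because odd squares are 1
  mod 8. Then \<open>b\<close> is odd, and \<open>b = 2 * x + 1\<close> forces
  \<open>a * c = 2 * (n - tri x) + 1\<close>, so \<open>a\<close> runs over the divisors of that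
  number. Negative \<open>b\<close> gives an equal contribution.\<close>

lemma sum_sigma_eq_0:
  "(\<Sum>x | tri x \<le> n. (int n - 5 * int (tri x)) * int (sigma (2 * (n - tri x) + 1))) = 0"
proof -
  define N where "N = 8 * int n + 5"
  have nsq: "x\<^sup>2 \<noteq> N" for x
  proof
    assume "x\<^sup>2 = N"
    moreover from this have "odd (x\<^sup>2)"
      by (simp add: N_def)
    then have "odd x" by simp
    then obtain y where "x = 2 * y + 1" by (elim oddE)
    ultimately have "y * (y + 1) = 2 * int n + 1"
      by (simp add: N_def power2_eq_square algebra_simps)
    moreover have "even (y * (y + 1))" by simp
    ultimately show False by presburger
  qed
  let ?f = "\<lambda>(a, b, c). a * (a * c - b\<^sup>2) :: int"
  define F where "F = {(a, b, c) \<in> forms N. b > 0}"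
  define F' where "F' = {(a, b, c) \<in> forms N. b < 0}"
  have b0: "b \<noteq> 0" if "(a, b, c) \<in> forms N" for a b c
    using that by (auto simp: forms_def N_def mult.assoc) presburger
  then have split: "forms N = F \<union> F'"
    unfolding F_def F'_def by (auto simp: neq_iff)
  have "sum ?f (forms N) = sum ?f F + sum ?f F'"
    unfolding split
    by (rule sum.union_disjoint) (auto simp: F_def F'_def intro: finite_subset[OF _ finite_forms])
  also have "sum ?f F' = sum ?f F"
    by (rule sum.reindex_bij_witness[where i = "\<lambda>(a, b, c). (a, -b, c)" and j = "\<lambda>(a, b, c). (a, -b, c)"])
       (auto simp: forms_def F_def F'_def)
  finally have F0: "sum ?f F = 0"
    using sum_forms_eq_0[OF nsq] by simp
  define m where "m x = 2 * (n - tri x) + 1" for x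
  have m: "4 * int (m x) = N - (2 * int x + 1)\<^sup>2" if "tri x \<le> n" for x
  proof -
    have "2 * int (tri x) = int x * (int x + 1)"
      using double_tri[of x] by (metis of_nat_1 of_nat_add of_nat_mult of_nat_numeral)
    then show ?thesis
      using that unfolding m_def N_def by (simp add: of_nat_diff power2_eq_square algebra_simps)
  qed
  have "sum ?f F = (\<Sum>(x, d)\<in>(SIGMA x:{x. tri x \<le> n}. {d. d dvd m x}).
          int d * (int (m x) - (2 * int x + 1)\<^sup>2))"
  proof (rule sum.reindex_bij_witness[where
        i = "\<lambda>(x, d). (int d, 2 * int x + 1, int (m x div d))" and
        j = "\<lambda>(a, b, c). (nat (b div 2), nat a)"])
    fix t assume "t \<in> F"
    then obtain a b c where t: "t = (a, b, c)" and abc: "a > 0" "b > 0" "c > 0"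
      and eq: "b\<^sup>2 + 4 * a * c = N"
      by (auto simp: F_def forms_def)
    have "b\<^sup>2 = 2 * (4 * int n + 2 - 2 * (a * c)) + 1"
      using eq unfolding N_def by simp
    then have "odd (b\<^sup>2)" by simp
    then have "odd b" by simp
    then have b: "b = 2 * int (nat (b div 2)) + 1"
      using abc odd_two_times_div_two_succ[of b] by (simp add: pos_imp_zdiv_nonneg_iff)
    define x where "x = nat (b div 2)"
    have bx: "b = 2 * int x + 1" using b unfolding x_def .
    have le: "tri x \<le> n"
    proof -
      have "a * c > 0" using abc by simp
      then have "(2 * int x + 1)\<^sup>2 < 8 * int n + 5"
        using eq unfolding N_def bx by simp
      moreover have "(2 * int x + 1)\<^sup>2 = 8 * int (tri x) + 1"
        using arg_cong[OF double_tri[of x], of int] by (simp add: power2_eq_square algebra_simps)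
      ultimately show ?thesis by simp
    qed
    have mx: "int (m x) = a * c"
      using m[OF le] eq unfolding bx by simp
    have mx': "m x = nat a * nat c"
      using mx abc by (metis nat_int nat_mult_distrib order_less_imp_le)
    have t': "(case t of (a, b, c) \<Rightarrow> (nat (b div 2), nat a)) = (x, nat a)"
      by (simp add: t x_def)
    show "(case (case t of (a, b, c) \<Rightarrow> (nat (b div 2), nat a)) of
            (x, d) \<Rightarrow> (int d, 2 * int x + 1, int (m x div d))) = t"
      unfolding t' using abc by (simp add: mx' t bx)
    show "(case t of (a, b, c) \<Rightarrow> (nat (b div 2), nat a)) \<in>
            (SIGMA x:{x. tri x \<le> n}. {d. d dvd m x})"
      unfolding t' using le mx' by simp
    show "(case (case t of (a, b, c) \<Rightarrow> (nat (b div 2), nat a)) of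
            (x, d) \<Rightarrow> int d * (int (m x) - (2 * int x + 1)\<^sup>2)) = ?f t"
      unfolding t' using abc by (simp add: t mx bx)
  next
    fix s assume "s \<in> (SIGMA x:{x. tri x \<le> n}. {d. d dvd m x})"
    then obtain x d where s: "s = (x, d)" and le: "tri x \<le> n" and d: "d dvd m x"
      by auto
    show "(case (case s of (x, d) \<Rightarrow> (int d, 2 * int x + 1, int (m x div d))) of
            (a, b, c) \<Rightarrow> (nat (b div 2), nat a)) = s"
      by (simp add: s)
    have "m x > 0" by (simp add: m_def)
    then have pos: "d > 0" "m x div d > 0"
      using d by (auto intro: dvd_pos_nat simp: dvd_imp_le div_greater_zero_iff)
    have "int d * int (m x div d) = int (m x)"
      using d by (metis dvd_mult_div_cancel of_nat_mult)
    then show "(case s of (x, d) \<Rightarrow> (int d, 2 * int x + 1, int (m x div d))) \<in> F"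
      using m[OF le] pos by (simp add: s F_def forms_def del: of_nat_div)
  qed
  also have "\<dots> = (\<Sum>x | tri x \<le> n. \<Sum>d | d dvd m x. int d * (int (m x) - (2 * int x + 1)\<^sup>2))"
    by (rule sum.Sigma[symmetric]) (simp_all add: finite_tri_le m_def)
  also have "\<dots> = (\<Sum>x | tri x \<le> n. 2 * ((int n - 5 * int (tri x)) * int (sigma (m x))))"
  proof (rule sum.cong[OF refl])
    fix x assume "x \<in> {x. tri x \<le> n}"
    then have "int (m x) - (2 * int x + 1)\<^sup>2 = 2 * (int n - 5 * int (tri x))"
      using arg_cong[OF double_tri[of x], of int]
      by (simp add: m_def of_nat_diff power2_eq_square algebra_simps)
    then show "(\<Sum>d | d dvd m x. int d * (int (m x) - (2 * int x + 1)\<^sup>2)) =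
        2 * ((int n - 5 * int (tri x)) * int (sigma (m x)))"
      by (simp add: sigma_def sum_distrib_right[symmetric] mult.commute)
  qed
  finally show ?thesis
    using F0 by (simp add: m_def sum_distrib_left[symmetric])
qed

section \<open>The fourth power of the theta series\<close>

unbundle fps_syntax

text \<open>Ramanujan's theta function \<open>psi(q)\<close>, with coefficients in a field of
  characteristic 0 so that it can be inverted and a series with zero derivative is constant.\<close>

definition psi :: "real fps" where
  "psi = Abs_fps (\<lambda>n. if n \<in> range tri then 1 else 0)"

text \<open>With \<open>G\<close> the series of divisor sums, \<open>G / psi^4\<close> has
  derivative zero and constant term 1. The derivative vanishes because
  \<open>G' * psi = 4 * G * psi'\<close>, which is the divisor-sum recurrence.\<close>

lemma psi_power_4: "psi ^ 4 = Abs_fps (\<lambda>n. real (sigma (2 * n + 1)))"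
proof -
  define G where "G = Abs_fps (\<lambda>n. real (sigma (2 * n + 1)))"
  have psi0: "psi $ 0 = 1"
    using range_eqI[of 0 tri 0] by (simp add: psi_def tri_def)
  \<comment> \<open>The factor \<open>fps_X\<close> makes differentiation multiply the coefficient
    at \<open>k\<close> by \<open>k\<close>. The weights \<open>n - k\<close> from \<open>G'\<close>
    and \<open>4 * k\<close> from \<open>psi'\<close> then combine to
    \<open>n - 5 * k\<close>.\<close>
  have "fps_X * (fps_deriv G * psi) = fps_X * (4 * G * fps_deriv psi)"
  proof (rule fps_ext)
    fix n
    define t where "t k = (if k \<in> range tri then (real n - 5 * real k) * G $ (n - k) else 0)" for k
    have nth: "(fps_X * fps_deriv f) $ k = real k * f $ k" for f :: "real fps" and k
      by (cases k) simp_all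
    have "(fps_X * (fps_deriv G * psi)) $ n - (fps_X * (4 * G * fps_deriv psi)) $ n
        = (psi * (fps_X * fps_deriv G)) $ n - 4 * ((fps_X * fps_deriv psi) * G) $ n"
      by (simp add: mult.assoc mult.left_commute[of _ "4"] mult.commute[of psi] mult.commute[of G] numeral_fps_const)
    also have "\<dots> = (\<Sum>k=0..n. t k)"
      unfolding fps_mult_nth[of psi] fps_mult_nth[of _ G] nth sum_distrib_left sum_subtractf[symmetric]
      by (rule sum.cong) (auto simp: psi_def t_def of_nat_diff algebra_simps)
    also have "\<dots> = sum t (tri ` {x. tri x \<le> n})"
      by (rule sum.mono_neutral_right) (auto simp: t_def)
    also have "\<dots> = (\<Sum>x | tri x \<le> n. t (tri x))"
      by (rule sum.reindex_cong[of tri]) (auto intro: inj_on_subset[OF inj_tri])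
    also have "\<dots> = real_of_int (\<Sum>x | tri x \<le> n.
        (int n - 5 * int (tri x)) * int (sigma (2 * (n - tri x) + 1)))"
      unfolding of_int_sum by (rule sum.cong) (auto simp: t_def G_def)
    also have "\<dots> = 0"
      by (simp only: sum_sigma_eq_0 of_int_0)
    finally show "(fps_X * (fps_deriv G * psi)) $ n = (fps_X * (4 * G * fps_deriv psi)) $ n"
      by simp
  qed
  then have ode: "fps_deriv G * psi = 4 * G * fps_deriv psi"
    by simp
  define Q where "Q = inverse psi"
  have Q: "Q * psi = 1"
    unfolding Q_def by (rule inverse_mult_eq_1) (simp add: psi0)
  have dQ: "fps_deriv Q = - fps_deriv psi * Q\<^sup>2"
    unfolding Q_def by (rule fps_inverse_deriv) (simp add: psi0)
  have "fps_deriv (Q ^ 4) = 4 * Q ^ 3 * fps_deriv Q"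
    by (simp add: fps_deriv_power numeral_fps_const mult_ac)
  then have "fps_deriv (G * Q ^ 4) = fps_deriv G * Q ^ 4 * (Q * psi) - 4 * G * fps_deriv psi * Q ^ 5"
    unfolding Q by (simp add: dQ algebra_simps power_numeral_reduce)
  also have "\<dots> = Q ^ 5 * (fps_deriv G * psi - 4 * G * fps_deriv psi)"
    by (simp add: algebra_simps power_numeral_reduce)
  finally have "fps_deriv (G * Q ^ 4) = 0"
    by (simp add: ode)
  then have "G * Q ^ 4 = fps_const ((G * Q ^ 4) $ 0)"
    by (simp only: fps_deriv_eq_0_iff)
  also have "(G * Q ^ 4) $ 0 = 1"
    by (simp add: fps_power_zeroth Q_def psi0 G_def sigma_def)
  finally have "G * (Q * psi) ^ 4 = psi ^ 4"
    by (simp add: power_mult_distrib flip: mult.assoc)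
  then show ?thesis
    by (simp add: Q G_def)
qed


section \<open>Representations with a vanishing summand\<close>

text \<open>
  Order the points by \<open>a - b\<close>. The points whose successor is more than \<open>S\<close> away are few for lack of
  room. Each other point \<open>(a, b)\<close> has a neighbour \<open>(a + p, b - q)\<close> with \<open>p + q \<le> S\<close>, and \<open>(p, q)\<close>
  determines it: subtracting the two equations gives an increasing linear relation between
  \<open>a\<close> and \<open>b\<close>, which meets the decreasing curve at most once.
\<close>

lemma card_two_triangular:
  assumes "m < tri (Suc r)"
  shows "Suc S * card {(a, b). tri a + tri b = m} \<le> Suc S * (\<Sum>p=1..<S. S - p) + (2 * r + S + 1)"
proof -
  define R where "R = {(a, b). tri a + tri b = m}"
  have less_r: "a \<le> r" if "tri a \<le> m" for a
    using strict_mono_less[OF strict_mono_tri, of a "Suc r"] that assms by simp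
  have R_le: "a \<le> r" "b \<le> r" if "(a, b) \<in> R" for a b
    using that less_r by (auto simp: R_def)
  have fin: "finite R"
    by (rule finite_subset[of _ "{..r} \<times> {..r}"]) (use R_le in auto)
  have R_mono: "a < c \<longleftrightarrow> d < b" if "(a, b) \<in> R" "(c, d) \<in> R" for a b c d
    using that strict_mono_less[OF strict_mono_tri, of a c] strict_mono_less[OF strict_mono_tri, of d b]
    by (auto simp: R_def)
  \<comment> \<open>This is \<open>a - b\<close>, shifted by \<open>r \<ge> b\<close> to stay within
    the naturals. It is injective on \<open>R\<close> since one coordinate rises as the other
    falls.\<close>
  define u where "u = (\<lambda>(a, b). r + a - b)"
  have u_le: "u z \<le> 2 * r" if "z \<in> R" for z
    using that R_le by (cases z) (fastforce simp: u_def)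
  have u_inj: "z = w" if "z \<in> R" "w \<in> R" "u z = u w" for z w
  proof -
    obtain a b c d where zw: "z = (a, b)" "w = (c, d)" by fastforce
    have "a < c \<longleftrightarrow> d < b" "c < a \<longleftrightarrow> b < d"
      using R_mono that(1,2) unfolding zw by blast+
    moreover have "b \<le> r" "d \<le> r"
      using R_le that(1,2) unfolding zw by blast+
    ultimately show ?thesis
      using that(3) by (auto simp: zw u_def)
  qed
  define I where "I = {z \<in> R. \<forall>w\<in>R. u z < u w \<longrightarrow> u z + S < u w}"
  \<comment> \<open>The intervals \<open>{u z..u z + S}\<close> for \<open>z\<close> in
    \<open>I\<close> are disjoint and lie in \<open>{0..2 * r + S}\<close>.\<close>
  have "card I * Suc S = card (I \<times> {0..S})"
    by (simp add: card_cartesian_product)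
  also have "\<dots> \<le> card {0..2 * r + S}"
  proof (rule card_inj_on_le)
    show "inj_on (\<lambda>(z, i). u z + i) (I \<times> {0..S})"
    proof (rule inj_onI)
      fix s t assume st: "s \<in> I \<times> {0..S}" "t \<in> I \<times> {0..S}"
        and eq: "(\<lambda>(z, i). u z + i) s = (\<lambda>(z, i). u z + i) t"
      obtain z i w j where zw: "s = (z, i)" "t = (w, j)" by fastforce
      have "z \<in> R" "w \<in> R" "u z < u w \<longrightarrow> u z + S < u w" "u w < u z \<longrightarrow> u w + S < u z"
        using st unfolding zw I_def by auto
      moreover from this have "u z = u w"
        using st eq by (auto simp: zw)
      ultimately show "s = t"
        using u_inj[of z w] eq by (simp add: zw)
    qed
    show "(\<lambda>(z, i). u z + i) ` (I \<times> {0..S}) \<subseteq> {0..2 * r + S}"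
      using u_le by (fastforce simp: I_def)
  qed simp
  finally have card_I: "Suc S * card I \<le> 2 * r + S + 1"
    by (simp add: mult.commute)
  \<comment> \<open>The possible steps: \<open>p\<close> and \<open>q\<close> are positive with
    \<open>p + q \<le> S\<close>.\<close>
  define D where "D = (SIGMA p:{1..<S}. {1..S - p})"
  have ex: "\<exists>(p, q)\<in>D. q \<le> snd z \<and> (fst z + p, snd z - q) \<in> R" if "z \<in> R - I" for z
  proof -
    obtain a b where z: "z = (a, b)" by fastforce
    obtain c d where cd: "(c, d) \<in> R" "u (a, b) < u (c, d)" "u (c, d) \<le> u (a, b) + S"
      using \<open>z \<in> R - I\<close> unfolding z I_def by fastforce
    have ab: "(a, b) \<in> R" using that z by simp
    have bd: "b \<le> r" "d \<le> r" using R_le ab cd by blast+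
    have "a < c \<longleftrightarrow> d < b" "c < a \<longleftrightarrow> b < d" using R_mono ab cd by blast+
    then have "a < c" "d < b" "c - a + (b - d) \<le> S"
      using cd(2,3) bd by (auto simp: u_def)
    then show ?thesis
      using cd(1) by (intro bexI[of _ "(c - a, b - d)"]) (auto simp: z D_def)
  qed
  obtain f where f: "\<And>z. z \<in> R - I \<Longrightarrow> f z \<in> D \<and> snd (f z) \<le> snd z
      \<and> (fst z + fst (f z), snd z - snd (f z)) \<in> R"
    by (atomize_elim, intro choice allI) (use ex in \<open>fastforce simp: case_prod_unfold\<close>)
  have linear: "int p * (2 * int a + int p + 1) = int q * (2 * int b - int q + 1)"
    if ab: "(a, b) \<in> R" and shift: "(a + p, b - q) \<in> R" and "q \<le> b" for a b p q
  proof -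
    have T: "2 * int (tri x) = int x * (int x + 1)" for x
      using arg_cong[OF double_tri[of x], of int] by (simp add: algebra_simps)
    have "int (tri a) + int (tri b) = int (tri (a + p)) + int (tri (b - q))"
      using ab shift unfolding R_def by (simp flip: of_nat_add)
    then have "int a * (int a + 1) + int b * (int b + 1) =
        int (a + p) * (int (a + p) + 1) + int (b - q) * (int (b - q) + 1)"
      unfolding T[symmetric] by simp
    then show ?thesis
      using \<open>q \<le> b\<close> by (simp add: of_nat_diff algebra_simps)
  qed
  have not_less: "\<not> a < c" if "(a, b) \<in> R - I" "(c, d) \<in> R - I" "f (a, b) = f (c, d)" for a b c d
  proof
    assume "a < c"
    obtain p q where pq: "f (a, b) = (p, q)" by fastforce
    have pos: "p > 0" "q > 0"
      using f[OF that(1)] by (auto simp: pq D_def)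
    have "d < b" using R_mono that \<open>a < c\<close> by blast
    have "int p * (2 * int a + int p + 1) = int q * (2 * int b - int q + 1)"
      using f[OF that(1)] that(1) by (intro linear) (auto simp: pq)
    moreover have "int p * (2 * int c + int p + 1) = int q * (2 * int d - int q + 1)"
      using f[OF that(2)] that(2) by (intro linear) (simp_all add: pq that(3)[symmetric])
    moreover have "int p * (2 * int a + int p + 1) < int p * (2 * int c + int p + 1)"
      using pos \<open>a < c\<close> by simp
    moreover have "int q * (2 * int d - int q + 1) < int q * (2 * int b - int q + 1)"
      using pos \<open>d < b\<close> by simp
    ultimately show False by linarith
  qed
  have "inj_on f (R - I)"
  proof (rule inj_onI)
    fix z w assume *: "z \<in> R - I" "w \<in> R - I" "f z = f w"
    obtain a b c d where zw: "z = (a, b)" "w = (c, d)" by fastforce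
    have "a = c"
      using not_less[of a b c d] not_less[of c d a b] * unfolding zw by simp
    moreover have "b = d"
      using * \<open>a = c\<close> inj_eq[OF inj_tri, of b d] by (simp add: zw R_def)
    ultimately show "z = w" by (simp add: zw)
  qed
  moreover have "f ` (R - I) \<subseteq> D" using f by blast
  ultimately have "card (R - I) \<le> card D"
    by (rule card_inj_on_le) (simp add: D_def)
  also have "card D = (\<Sum>p=1..<S. S - p)"
    by (simp add: D_def)
  finally have "card (R - I) \<le> (\<Sum>p=1..<S. S - p)" .
  moreover have "card R = card I + card (R - I)"
    using fin by (subst card_Un_disjoint[symmetric]) (auto simp: I_def intro!: arg_cong[of _ _ card])
  ultimately have "Suc S * card R \<le> Suc S * card I + Suc S * (\<Sum>p=1..<S. S - p)"
    unfolding add_mult_distrib2[symmetric] by (intro mult_le_mono) simp_all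
  then show ?thesis
    using card_I unfolding R_def[symmetric] by linarith
qed

section \<open>Series with and without the zero index\<close>

definition phi :: "real fps" where
  "phi = Abs_fps (\<lambda>n. if n \<in> tri ` {0<..} then 1 else 0)"

lemma psi_eq_phi_plus_1: "psi = phi + 1"
proof (rule fps_ext)
  fix n
  have "psi $ n = (if n = 0 then 1 else 0) + phi $ n"
  proof (cases "n = 0")
    case True
    have "0 \<in> range tri" by (metis tri_0 rangeI)
    moreover have "0 \<notin> tri ` {0<..}"
      using le_tri by (metis greaterThan_iff imageE leD)
    ultimately show ?thesis
      using True by (simp add: psi_def phi_def)
  next
    case False
    have "n \<in> range tri \<longleftrightarrow> n \<in> tri ` {0<..}"
    proof
      assume "n \<in> range tri"
      then obtain x where x: "n = tri x" by blast
      then have "x \<noteq> 0" using False by (metis tri_0)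
      then show "n \<in> tri ` {0<..}" using x by simp
    qed blast
    then show ?thesis using False by (simp add: psi_def phi_def)
  qed
  then show "psi $ n = (phi + 1) $ n" by simp
qed

lemma psi_square_nth: "psi\<^sup>2 $ m = real (card {(a, b). tri a + tri b = m})"
proof -
  have "psi\<^sup>2 $ m = (\<Sum>i\<in>{0..m}. if i \<in> range tri \<and> m - i \<in> range tri then 1 else 0)"
    unfolding power2_eq_square fps_mult_nth by (rule sum.cong) (auto simp: psi_def)
  also have "\<dots> = real (card {i \<in> {0..m}. i \<in> range tri \<and> m - i \<in> range tri})"
    by (simp flip: sum.inter_filter)
  also have "card {i \<in> {0..m}. i \<in> range tri \<and> m - i \<in> range tri} = card {(a, b). tri a + tri b = m}"
  proof (rule bij_betw_same_card[symmetric])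
    show "bij_betw (\<lambda>(a, b). tri a) {(a, b). tri a + tri b = m}
        {i \<in> {0..m}. i \<in> range tri \<and> m - i \<in> range tri}"
      unfolding bij_betw_def
    proof
      show "inj_on (\<lambda>(a, b). tri a) {(a, b). tri a + tri b = m}"
        by (auto simp: inj_on_def inj_eq[OF inj_tri])
      show "(\<lambda>(a, b). tri a) ` {(a, b). tri a + tri b = m} =
          {i \<in> {0..m}. i \<in> range tri \<and> m - i \<in> range tri}"
      proof (intro equalityI subsetI)
        fix i assume "i \<in> {i \<in> {0..m}. i \<in> range tri \<and> m - i \<in> range tri}"
        then obtain a b where "i = tri a" "m - i = tri b" "i \<le> m" by auto
        then show "i \<in> (\<lambda>(a, b). tri a) ` {(a, b). tri a + tri b = m}"
          by (intro image_eqI[of _ _ "(a, b)"]) auto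
      qed auto
    qed
  qed
  finally show ?thesis .
qed

text \<open>Nonnegativity of the smaller series is included so that the relation is compatible with
  products.\<close>

definition fps_le :: "real fps \<Rightarrow> real fps \<Rightarrow> bool" where
  "fps_le f g \<longleftrightarrow> (\<forall>n. 0 \<le> f $ n \<and> f $ n \<le> g $ n)"

lemma fps_le_mult: "fps_le f g \<Longrightarrow> fps_le h k \<Longrightarrow> fps_le (f * h) (g * k)"
  unfolding fps_le_def fps_mult_nth
  by (auto intro!: sum_mono sum_nonneg mult_mono intro: order_trans)

text \<open>Since \<open>psi - phi = 1\<close>, the difference \<open>psi^4 - phi^4\<close> is
  \<open>psi^3 + psi^2 * phi + psi * phi^2 + phi^3\<close>, and each of these four terms is at most
  \<open>psi^3\<close>. They sort the quadruples by the position of a vanishing entry.\<close>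

lemma psi_power_4_le: "psi ^ 4 $ n \<le> phi ^ 4 $ n + 4 * psi ^ 3 $ n"
proof -
  have *: "fps_le phi psi" "fps_le psi psi"
    unfolding psi_eq_phi_plus_1 by (auto simp: fps_le_def phi_def)
  have "fps_le (psi * psi * phi) (psi * psi * psi)" "fps_le (psi * phi * phi) (psi * psi * psi)"
    "fps_le (phi * phi * phi) (psi * psi * psi)"
    by (intro fps_le_mult *)+
  then have "(psi * psi * phi) $ n \<le> psi ^ 3 $ n" "(psi * phi * phi) $ n \<le> psi ^ 3 $ n"
    "(phi * phi * phi) $ n \<le> psi ^ 3 $ n"
    by (auto simp: fps_le_def power3_eq_cube)
  moreover have "psi ^ 4 = phi ^ 4 + psi ^ 3 + psi * psi * phi + psi * phi * phi + phi * phi * phi"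
    unfolding psi_eq_phi_plus_1 by (simp add: power_numeral_reduce algebra_simps)
  then have "psi ^ 4 $ n = phi ^ 4 $ n + psi ^ 3 $ n + (psi * psi * phi) $ n
      + (psi * phi * phi) $ n + (phi * phi * phi) $ n"
    by simp
  ultimately show ?thesis by linarith
qed

text \<open>One entry of a triple has at most \<open>r + 1\<close> values, and each leaves at most
  \<open>r / 4\<close> pairs for the other two.\<close>

lemma psi_cube_le:
  assumes "n < tri (Suc r)" "672 \<le> r"
  shows "4 * psi ^ 3 $ n \<le> real (r * (r + 1))"
proof -
  have sq: "4 * psi\<^sup>2 $ m \<le> real r" if "m \<le> n" for m
  proof -
    \<comment> \<open>With \<open>S = 11\<close> the bound on the number of pairs is
      \<open>(672 + 2 * r) / 12\<close>, which is at most \<open>r / 4\<close> exactly when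
      \<open>r \<ge> 672\<close>. This \<open>S\<close> gives the smallest such threshold.\<close>
    have "(\<Sum>p=1..<11. 11 - p) = (55 :: nat)"
      by (simp add: numeral_eq_Suc)
    then have "12 * card {(a, b). tri a + tri b = m} \<le> 660 + (2 * r + 12)"
      using card_two_triangular[of m r 11] that assms by simp
    then have "4 * card {(a, b). tri a + tri b = m} \<le> r"
      using assms by linarith
    then show ?thesis
      unfolding psi_square_nth by linarith
  qed
  have "card {i \<in> {0..n}. i \<in> range tri} \<le> card (tri ` {..r})"
  proof (rule card_mono)
    show "{i \<in> {0..n}. i \<in> range tri} \<subseteq> tri ` {..r}"
    proof clarify
      fix x assume "tri x \<in> {0..n}"
      then have "tri x < tri (Suc r)" using assms by simp
      then show "tri x \<in> tri ` {..r}"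
        using strict_mono_less[OF strict_mono_tri] by simp
    qed
  qed simp
  also have "\<dots> \<le> r + 1"
    using card_image_le[of "{..r}" tri] by simp
  finally have card: "card {i \<in> {0..n}. i \<in> range tri} \<le> r + 1" .
  have "4 * psi ^ 3 $ n = (\<Sum>i\<in>{0..n}. psi $ i * (4 * psi\<^sup>2 $ (n - i)))"
    unfolding power3_eq_cube power2_eq_square mult.assoc[of psi psi psi] fps_mult_nth[of psi "psi * psi"]
    by (simp add: sum_distrib_left mult_ac)
  also have "\<dots> \<le> (\<Sum>i\<in>{0..n}. if i \<in> range tri then real r else 0)"
    by (rule sum_mono) (auto simp: psi_def intro: sq[unfolded psi_def])
  also have "\<dots> = real r * real (card {i \<in> {0..n}. i \<in> range tri})"
    by (simp flip: sum.inter_filter)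
  also have "\<dots> \<le> real r * real (r + 1)"
    using card by (intro mult_left_mono) auto
  finally show ?thesis by (simp only: of_nat_mult)
qed

lemma sigma_ge:
  assumes "m > 1"
  shows "m + 1 \<le> sigma m"
proof -
  have "\<Sum>{1, m} \<le> sigma m"
    unfolding sigma_def using assms by (intro sum_mono2) auto
  then show ?thesis using assms by simp
qed

lemma fps_mult_nth_nonzero:
  fixes f g :: "'a::semiring_0 fps"
  assumes "(f * g) $ n \<noteq> 0"
  obtains i j where "n = i + j" "f $ i \<noteq> 0" "g $ j \<noteq> 0"
proof -
  obtain i where "i \<in> {0..n}" "f $ i * g $ (n - i) \<noteq> 0"
    using assms unfolding fps_mult_nth by (meson sum.not_neutral_contains_not_neutral)
  then show ?thesis
    using that[of i "n - i"] by (metis atLeastAtMost_iff le_add_diff_inverse mult_zero_left mult_zero_right)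
qed

section \<open>Four positive triangular numbers for large targets\<close>

definition four_positive_triangular :: "nat \<Rightarrow> bool" where
  "four_positive_triangular n \<longleftrightarrow> (\<exists>a>0. \<exists>b>0. \<exists>c>0. \<exists>d>0. n = tri a + tri b + tri c + tri d)"

lemma tri_bracket: obtains r where "tri r \<le> n" "n < tri (Suc r)"
proof -
  define r where "r = Max {x. tri x \<le> n}"
  have ne: "0 \<in> {x. tri x \<le> n}" by simp
  have "r \<in> {x. tri x \<le> n}"
    unfolding r_def using finite_tri_le ne by (metis Max_in empty_iff)
  moreover have "Suc r \<notin> {x. tri x \<le> n}"
    using Max_ge[OF finite_tri_le[of n], of "Suc r"] unfolding r_def by linarith
  ultimately show ?thesis using that by simp
qed

text \<open>If \<open>tri r\<close> is the largest triangular number up to \<open>n\<close>,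
  quadruples with a zero entry number at most \<open>r * (r + 1) = 2 * tri r \<le> 2 * n\<close>,
  while there are at least \<open>2 * n + 2\<close> quadruples in all.\<close>

lemma four_positive_triangular_large:
  assumes "tri 672 \<le> n"
  shows "four_positive_triangular n"
proof -
  obtain r where r: "tri r \<le> n" "n < tri (Suc r)" by (rule tri_bracket)
  have "tri 672 < tri (Suc r)" using assms r by simp
  then have "672 \<le> r"
    using strict_mono_less[OF strict_mono_tri] by simp
  then have cube: "4 * psi ^ 3 $ n \<le> real (r * (r + 1))"
    using r psi_cube_le by blast
  have "r * (r + 1) \<le> 2 * n"
    using r double_tri[of r] by simp
  then have "real (r * (r + 1)) \<le> real (2 * n)"
    by (simp only: of_nat_le_iff)
  moreover have "real (2 * n + 2) \<le> psi ^ 4 $ n"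
    using sigma_ge[of "2 * n + 1"] le_tri[of 672] assms unfolding psi_power_4 by simp
  ultimately have "phi ^ 4 $ n > 0"
    using cube psi_power_4_le[of n] by simp
  then have "((phi * phi) * (phi * phi)) $ n \<noteq> 0"
    by (simp add: power_numeral_reduce mult_ac)
  then obtain i j where ij: "n = i + j" "(phi * phi) $ i \<noteq> 0" "(phi * phi) $ j \<noteq> 0"
    by (rule fps_mult_nth_nonzero)
  obtain i1 i2 where "i = i1 + i2" "phi $ i1 \<noteq> 0" "phi $ i2 \<noteq> 0"
    using ij(2) by (rule fps_mult_nth_nonzero)
  moreover obtain j1 j2 where "j = j1 + j2" "phi $ j1 \<noteq> 0" "phi $ j2 \<noteq> 0"
    using ij(3) by (rule fps_mult_nth_nonzero)
  ultimately show ?thesis using ij(1)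
    unfolding four_positive_triangular_def
    by (auto simp: phi_def add.assoc[symmetric] split: if_splits)
qed

section \<open>Small numbers\<close>

text \<open>Here \<open>r\<close> is the difference between the target and \<open>T x + T y\<close>.\<close>

function two_pointer :: "int \<Rightarrow> int \<Rightarrow> int \<Rightarrow> bool" where
  "two_pointer r x y \<longleftrightarrow> (if x > y then False else if r = 0 then True
     else if r > 0 then two_pointer (r - (x + 1)) (x + 1) y else two_pointer (r + y) x (y - 1))"
  by pat_completeness auto
termination by (relation "measure (\<lambda>(r, x, y). nat (y + 1 - x))") auto

declare two_pointer.simps [simp del]

text \<open>The value \<open>tri x + tri y + r\<close> is invariant: raising \<open>x\<close> adds
  \<open>x + 1\<close> and lowering \<open>y\<close> removes \<open>y\<close>. As \<open>x\<close>
  only grows and success requires \<open>x \<le> y\<close>, both indices found are positive.\<close>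

lemma two_pointer_sound:
  assumes "two_pointer r x y" "x > 0"
  shows "\<exists>a>0. \<exists>b>0. int (tri a + tri b) = int (tri (nat x)) + int (tri (nat y)) + r"
  using assms
proof (induction r x y rule: two_pointer.induct)
  case (1 r x y)
  have xy: "0 < x" "x \<le> y" using 1 by (auto simp: two_pointer.simps[of r x y] split: if_splits)
  have pred: "int (tri (nat y)) = int (tri (nat (y - 1))) + y"
    using tri_Suc[of "nat (y - 1)"] xy by (simp add: nat_diff_distrib Suc_nat_eq_nat_zadd1)
  have succ: "int (tri (nat (x + 1))) = int (tri (nat x)) + x + 1"
    using tri_Suc[of "nat x"] xy by (simp add: nat_add_distrib)
  consider "r = 0" | "r > 0" | "r < 0" by linarith
  then show ?case
  proof cases
    case 1
    with xy show ?thesis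
      by (intro exI[of _ "nat x"] conjI exI[of _ "nat y"]) auto
  next
    case 2
    then have "two_pointer (r - (x + 1)) (x + 1) y"
      using "1.prems" by (auto simp: two_pointer.simps[of r x y] split: if_splits)
    then show ?thesis
      using "1.IH"(1) 2 xy by (simp add: succ add.assoc)
  next
    case 3
    then have "two_pointer (r + y) x (y - 1)"
      using "1.prems" by (auto simp: two_pointer.simps[of r x y] split: if_splits)
    then show ?thesis
      using "1.IH"(2) 3 xy by (simp add: pred add_ac)
  qed
qed

lemma tri_values: "tri 1 = 1" "tri 2 = 3" "tri 3 = 6" "tri 4 = 10" "tri 5 = 15" "tri 6 = 21"
  "tri 7 = 28" "tri 8 = 36" "tri 36 = 666"
  by (simp_all add: tri_def)

lemma triangular_literals:
  assumes "t \<in> set [1, 3, 6, 10, 15, 21, 28, 36]"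
  obtains c where "c > 0" "t = int (tri c)"
proof -
  have "t \<in> (\<lambda>c. int (tri c)) ` {1, 2, 3, 4, 5, 6, 7, 8}"
    using assms by (simp only: image_insert tri_values) auto
  then obtain c where "c \<in> {1, 2, 3, 4, 5, 6, 7, 8}" "t = int (tri c)" by blast
  then show ?thesis using that[of c] by auto
qed

text \<open>In the next two lemmas, \<open>667 = T 1 + T 36\<close> belongs to the initial pointers 1 and 36.\<close>

lemma two_pointer_after_one_triangular:
  "\<forall>n\<in>set [30..702]. \<exists>t\<in>set [1, 3, 6, 10, 15, 21, 28, 36].
    two_pointer (n - t - 667) 1 36"
  by code_simp

lemma two_pointer_after_two_triangulars:
  "\<forall>n\<in>set ([4, 6] @ [8..30]). \<exists>s\<in>set [1, 3, 6]. \<exists>t\<in>set [1, 3, 6, 10, 15, 21, 28, 36].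
    two_pointer (n - s - t - 667) 1 36"
  by code_simp

text \<open>The range starts at 30 because 29 is not such a sum. It ends just below
  \<open>tri 37 = 703\<close>, so no index above 36 can occur.\<close>

lemma three_positive_triangular:
  assumes "30 \<le> n" "n \<le> 702"
  obtains a b c where "a > 0" "b > 0" "c > 0" "n = tri a + tri b + tri c"
proof -
  have "int n \<in> set [30..702]" using assms unfolding set_upto by simp
  then obtain t where "t \<in> set [1, 3, 6, 10, 15, 21, 28, 36]" and *: "two_pointer (int n - t - 667) 1 36"
    using two_pointer_after_one_triangular by blast
  then obtain c where c: "c > 0" "t = int (tri c)"
    by (elim triangular_literals)
  obtain a b where "a > 0" "b > 0" "int (tri a + tri b) = int (tri 1) + int (tri 36) + (int n - t - 667)"
    using two_pointer_sound[OF *] by auto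
  then show ?thesis
    using that[of a b c] c unfolding tri_values by linarith
qed


lemma four_positive_triangular:
  assumes "4 \<le> n" "n \<noteq> 5" "n \<noteq> 7"
  shows "four_positive_triangular n"
proof -
  consider "n \<le> 30" | "31 \<le> n" "n < tri 672" | "tri 672 \<le> n" by linarith
  then show ?thesis
  proof cases
    case 1
    then have "int n \<in> set ([4, 6] @ [8..30])"
      using assms unfolding set_append set_upto by auto
    then obtain s t where s: "s \<in> set [1, 3, 6]" and t: "t \<in> set [1, 3, 6, 10, 15, 21, 28, 36]"
      and *: "two_pointer (int n - s - t - 667) 1 36"
      using two_pointer_after_two_triangulars by blast
    have "s \<in> set [1, 3, 6, 10, 15, 21, 28, 36]"
      using s by auto
    then obtain c where c: "c > 0" "s = int (tri c)" by (rule triangular_literals)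
    obtain d where d: "d > 0" "t = int (tri d)" using t by (rule triangular_literals)
    obtain a b where ab: "a > 0" "b > 0"
      "int (tri a + tri b) = int (tri 1) + int (tri 36) + (int n - s - t - 667)"
      using two_pointer_sound[OF *] by auto
    then have "n = tri a + tri b + tri c + tri d"
      using c d unfolding tri_values by linarith
    then show ?thesis
      using ab c d unfolding four_positive_triangular_def by blast
  next
    case 2
    \<comment> \<open>Bracketing \<open>n - 30\<close> instead of \<open>n\<close> leaves a
      remainder \<open>n - tri w\<close> between 30 and \<open>30 + w\<close>, with
      \<open>w < 672\<close>. Since \<open>n \<ge> 31\<close>, the index \<open>w\<close> is
      positive.\<close>
    obtain w where w: "tri w \<le> n - 30" "n - 30 < tri (Suc w)" by (rule tri_bracket)
    have "w > 0"
      using w 2 by (cases w) (auto simp: tri_def)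
    have "tri w < tri 672" using w 2 by linarith
    then have "w < 672" using strict_mono_less[OF strict_mono_tri] by simp
    then have "30 \<le> n - tri w" "n - tri w \<le> 702"
      using w 2 by (simp_all add: tri_Suc)
    then obtain a b c where "a > 0" "b > 0" "c > 0" "n - tri w = tri a + tri b + tri c"
      by (rule three_positive_triangular)
    moreover from this have "n = tri a + tri b + tri c + tri w"
      using w 2 by linarith
    ultimately show ?thesis
      using \<open>w > 0\<close> unfolding four_positive_triangular_def by blast
  qed (rule four_positive_triangular_large)
qed

section \<open>Integer arguments and the reduction to four summands\<close>

lemma triangular_tri: "triangular (int (tri x))"
  unfolding triangular_def tri_def by (intro exI[of _ "int x"]) (simp add: zdiv_int algebra_simps)

lemma triangular_nonzero_imp_tri:
  assumes "triangular t" "t \<noteq> 0"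
  obtains x where "x > 0" "t = int (tri x)"
proof -
  obtain y where y: "t = y * (y + 1) div 2"
    using assms(1) unfolding triangular_def by blast
  \<comment> \<open>The product \<open>y * (y + 1)\<close> is unchanged under
    \<open>y \<mapsto> - y - 1\<close>, which makes a negative root natural.\<close>
  define x where "x = nat (if y \<ge> 0 then y else - y - 1)"
  have "y * (y + 1) = int (x * (x + 1))"
    by (simp add: x_def algebra_simps)
  then have t: "t = int (tri x)"
    unfolding y tri_def by (simp add: zdiv_int)
  then have "x \<noteq> 0"
    using assms(2) by (metis of_nat_0 tri_0)
  then show ?thesis using that t by simp
qed

lemma triangular_nonzero_cases:
  assumes "triangular t" "t \<noteq> 0"
  shows "t = 1 \<or> t = 3 \<or> t \<ge> 6"
proof -
  obtain x where x: "x > 0" "t = int (tri x)"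
    using assms by (rule triangular_nonzero_imp_tri)
  consider "x = 1" | "x = 2" | "x \<ge> 3" using x(1) by linarith
  then show ?thesis
  proof cases
    case 3
    then have "tri 3 \<le> tri x"
      using strict_mono_less_eq[OF strict_mono_tri] by simp
    then show ?thesis using x by (simp add: tri_values)
  qed (use x in \<open>simp_all only: tri_values, simp_all\<close>)
qed

theorem theorem3p12:
  fixes k :: nat and n :: int
  assumes "k \<ge> 4" and "n > 0"
  shows "sum_of_nonzero_triangulars k n \<longleftrightarrow>
           n \<notin> {1..int k - 1} \<union> {int k + 1, int k + 3}"
proof
  assume "sum_of_nonzero_triangulars k n"
  then obtain t where t: "\<And>i. i < k \<Longrightarrow> triangular (t i) \<and> t i \<noteq> 0" and n: "n = (\<Sum>i<k. t i)"
    unfolding sum_of_nonzero_triangulars_def by blast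
  \<comment> \<open>Compare with \<open>k\<close> ones: each summand exceeds 1 by 0, 2 or at least
    5, so the total excess \<open>n - k\<close> is nonnegative and cannot be 1 or 3.\<close>
  have cases: "t i - 1 = 0 \<or> t i - 1 = 2 \<or> t i - 1 \<ge> 5" if "i < k" for i
    using triangular_nonzero_cases t[OF that] by fastforce
  have diff: "n - int k = (\<Sum>i<k. t i - 1)"
    by (simp add: n sum_subtractf)
  have nonneg: "t i - 1 \<ge> 0" if "i < k" for i
    using cases[OF that] by linarith
  have "n - int k \<ge> 0"
    unfolding diff using nonneg by (intro sum_nonneg) auto
  moreover have "n - int k \<ge> 5 \<or> even (n - int k)"
  proof (cases "\<exists>i<k. t i - 1 \<ge> 5")
    case True
    then obtain i where i: "i < k" "t i - 1 \<ge> 5" by blast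
    have "t i - 1 \<le> (\<Sum>i<k. t i - 1)"
      using i nonneg by (intro member_le_sum) auto
    then show ?thesis using i diff by linarith
  next
    case False
    then have "even (t i - 1)" if "i < k" for i
      using cases[OF that] that by auto
    then have "even (n - int k)"
      unfolding diff by (intro dvd_sum) auto
    then show ?thesis ..
  qed
  ultimately show "n \<notin> {1..int k - 1} \<union> {int k + 1, int k + 3}"
    by auto
next
  assume "n \<notin> {1..int k - 1} \<union> {int k + 1, int k + 3}"
  then have n: "n \<ge> int k" "n \<noteq> int k + 1" "n \<noteq> int k + 3"
    using assms by auto
  \<comment> \<open>Reserve \<open>k - 4\<close> summands equal to 1. The remainder \<open>m\<close>
    avoids 5 and 7 exactly because \<open>n\<close> avoids \<open>k + 1\<close> and
    \<open>k + 3\<close>.\<close>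
  define m where "m = nat (n - int k + 4)"
  have m: "int m = n - int k + 4" using n by (simp add: m_def)
  then have "4 \<le> m" "m \<noteq> 5" "m \<noteq> 7" using n by auto
  then have "four_positive_triangular m"
    by (rule four_positive_triangular)
  then obtain a b c d where abcd: "a > 0" "b > 0" "c > 0" "d > 0" "m = tri a + tri b + tri c + tri d"
    unfolding four_positive_triangular_def by blast
  \<comment> \<open>The default index 1 supplies the ones, as \<open>tri 1 = 1\<close>.\<close>
  define x where "x i = (if i = 0 then a else if i = 1 then b else if i = 2 then c
      else if i = 3 then d else 1)" for i :: nat
  have pos: "x i > 0" for i
    using abcd by (simp add: x_def)
  have nz: "int (tri (x i)) \<noteq> 0" for i
    using pos[of i] le_tri[of "x i"] by linarith
  have "{..<k} = {0, 1, 2, 3} \<union> {4..<k}"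
    using assms(1) by auto
  then have "(\<Sum>i<k. int (tri (x i))) = (\<Sum>i\<in>{0, 1, 2, 3}. int (tri (x i))) + (\<Sum>i=4..<k. int (tri (x i)))"
    by (simp only:) (intro sum.union_disjoint; auto)
  also have "(\<Sum>i=4..<k. int (tri (x i))) = (\<Sum>i=4..<k. 1)"
    by (intro sum.cong) (auto simp: x_def tri_def)
  also have "(\<Sum>i\<in>{0, 1, 2, 3}. int (tri (x i))) = int m"
    using abcd by (simp add: x_def)
  finally have "(\<Sum>i<k. int (tri (x i))) = n"
    using m assms(1) by (simp add: of_nat_diff)
  then show "sum_of_nonzero_triangulars k n"
    unfolding sum_of_nonzero_triangulars_def
    using nz triangular_tri by (intro exI[of _ "\<lambda>i. int (tri (x i))"]) auto
qed

end
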